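(* There are infinitely many positive integers $m$ for which the inequalities $$\sigma(2m+5)>\sigma(6m+17)\quad\text{and}\quad \sigma(5m+4)>\sigma(6m+7)$$ hold simultaneously.
   Context: $\sigma(n)=\sum_{d\mid n} d$ denotes the sum of the positive divisors of the positive integer $n$. *)

theory Defs
  imports Main
begin

definition sigma :: "nat \<Rightarrow> nat" where
  "sigma n = (\<Sum>d | d dvd n. d)"

end

theory Submission
  imports Defs Complex_Main
begin

text \<open>
  Take \<open>N = 3\<^sup>3 \<cdot> 5\<^sup>2 \<cdot> 7 \<cdot> 11 \<cdots> 37 = 166966608033225\<close>, with all primes from 7 to 37, so that
  \<open>\<sigma>(N) / N > 3.14\<close> and \<open>N \<equiv> 1 (mod 4)\<close>, and let \<open>m\<close> be given by \<open>2 m + 5 = (4 t + 1) N\<close>.  Then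
  \<open>\<sigma>(2 m + 5) \<ge> 3.14 (2 m + 5)\<close>, and since \<open>m\<close> is even, \<open>\<sigma>(5 m + 4) \<ge> 3/2 (5 m + 4)\<close>.  So both
  inequalities hold once \<open>\<sigma>(6 m + 17) < (1 + 1/25) (6 m + 17)\<close> and \<open>\<sigma>(6 m + 7) < (1 + 1/5) (6 m + 7)\<close>.

  These two numbers are coprime to \<open>12 N\<close>, hence have no prime factor below 41.  Summing
  \<open>\<sigma>(n) / n = (\<Sum>d | d dvd n. 1 / d)\<close> over \<open>t < T\<close> and exchanging the sums, the mean of \<open>\<sigma>(n) / n - 1\<close> is
  at most \<open>(\<Sum>d \<ge> 41. 1 / d\<^sup>2) + o(1) \<le> 1/40 + o(1)\<close> for each of them.  By Markov's inequality the bad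
  \<open>t\<close> have upper density at most \<open>25/40 + 5/40 < 1\<close>.
\<close>

section \<open>Divisor sums and lower bounds for \<open>sigma\<close>\<close>

lemma sum_inverse_divisors:
  assumes "n > 0"
  shows "(\<Sum>d | d dvd n. 1 / real d) = real (sigma n) / real n"
proof -
  have "(\<Sum>d | d dvd n. 1 / real d) = (\<Sum>d | d dvd n. real d / real n)"
    by (rule sum.reindex_bij_witness[where i = "\<lambda>d. n div d" and j = "\<lambda>d. n div d"])
       (use assms in \<open>auto simp: field_simps\<close>)
  then show ?thesis
    by (simp add: sigma_def sum_divide_distrib)
qed

lemma sigma_ge_sum:
  assumes "n > 0" "D \<subseteq> {d. d dvd n}"
  shows "\<Sum>D \<le> sigma n"
  unfolding sigma_def using assms by (intro sum_mono2) auto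

lemma sigma_ge_Suc: "n > 1 \<Longrightarrow> n + 1 \<le> sigma n"
  using sigma_ge_sum[of n "{1, n}"] by auto

text \<open>If d * e = d' * e' then d divides d' because d is coprime to e', and symmetrically. So
  the products of a divisor of \<open>a\<close> and a divisor of \<open>b\<close> are pairwise
  distinct divisors of \<open>a * b\<close>.\<close>

lemma sigma_mult_coprime_ge:
  assumes "coprime a b" "a > 0" "b > 0"
  shows "sigma a * sigma b \<le> sigma (a * b)"
proof -
  let ?P = "{d. d dvd a} \<times> {e. e dvd b}"
  have "inj_on (\<lambda>(d, e). d * e) ?P"
  proof (rule inj_onI, clarsimp)
    fix d e d' e'
    assume *: "d dvd a" "e dvd b" "d' dvd a" "e' dvd b" "d * e = d' * e'"
    have "coprime d e'" "coprime d' e"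
      using * assms(1) by (auto intro: coprime_divisors)
    then have "d dvd d'" "d' dvd d"
      using *(5) by (metis coprime_dvd_mult_left_iff dvd_triv_left)+
    then have "d = d'"
      by (rule dvd_antisym)
    moreover have "d > 0"
      using *(1) assms(2) by (auto intro: dvd_pos_nat)
    ultimately show "d = d' \<and> e = e'"
      using *(5) by simp
  qed
  then have "\<Sum>((\<lambda>(d, e). d * e) ` ?P) = (\<Sum>(d, e)\<in>?P. d * e)"
    by (simp add: sum.reindex case_prod_unfold)
  also have "\<dots> = sigma a * sigma b"
    by (simp add: sigma_def sum_product sum.cartesian_product)
  finally have "sigma a * sigma b = \<Sum>((\<lambda>(d, e). d * e) ` ?P)" ..
  also have "\<dots> \<le> sigma (a * b)"
    using assms by (intro sigma_ge_sum) (auto intro: mult_dvd_mono)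
  finally show ?thesis .
qed

text \<open>Multiplying the divisors of \<open>n\<close> by \<open>k\<close> gives distinct divisors
  of \<open>k * n\<close>. Thus \<open>sigma n / n\<close> never drops on passing to a multiple,
  whether or not \<open>k\<close> and \<open>n\<close> are coprime.\<close>

lemma sigma_mult_ge:
  assumes "k > 0" "n > 0"
  shows "k * sigma n \<le> sigma (k * n)"
proof -
  have "k * sigma n = \<Sum>((*) k ` {d. d dvd n})"
    using assms by (subst sum.reindex) (auto simp: inj_on_def sigma_def sum_distrib_left)
  also have "\<dots> \<le> sigma (k * n)"
    using assms by (intro sigma_ge_sum) auto
  finally show ?thesis .
qed

lemma sigma_even_ge:
  assumes "even n" "n > 0"
  shows "3 * n \<le> 2 * sigma n"
proof -
  obtain k where k: "n = k * 2"
    using assms(1) by (metis dvdE mult.commute)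
  have "k * 3 \<le> k * sigma 2"
    using sigma_ge_Suc[of 2] by (intro mult_left_mono) simp_all
  also have "\<dots> \<le> sigma n"
    unfolding k using assms(2) k by (intro sigma_mult_ge) simp_all
  finally show ?thesis
    using k by linarith
qed

section \<open>The mean of \<open>sigma n / n - 1\<close> along an arithmetic progression\<close>

text \<open>As \<open>A\<close> is invertible modulo \<open>d\<close>, the solutions lie in one
  residue class, so each block of \<open>d\<close> consecutive integers holds at most one; the last
  block may be incomplete, hence the \<open>+ 1\<close>.\<close>

lemma card_dvd_linear_le:
  fixes A B d T :: nat
  assumes "coprime A d" "d > 0"
  shows "card {t. t < T \<and> d dvd A * t + B} \<le> T div d + 1"
proof -
  let ?S = "{t. t < T \<and> d dvd A * t + B}"
  have "inj_on (\<lambda>t. t div d) ?S"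
  proof (rule inj_onI, clarsimp)
    fix s t
    assume *: "d dvd A * s + B" "d dvd A * t + B" "s div d = t div d"
    have "int d dvd int (A * s + B) - int (A * t + B)"
      using * by (intro dvd_diff) (simp_all only: int_dvd_int_iff)
    then have "int d dvd int A * (int s - int t)"
      by (simp add: algebra_simps)
    then have "int d dvd int s - int t"
      using assms by (subst (asm) coprime_dvd_mult_right_iff) (auto simp: coprime_commute)
    then have "int s mod int d = int t mod int d"
      by (simp add: mod_eq_dvd_iff)
    then have "s mod d = t mod d"
      by (metis of_nat_eq_iff zmod_int)
    then show "s = t"
      using *(3) by (metis div_mult_mod_eq)
  qed
  moreover have "(\<lambda>t. t div d) ` ?S \<subseteq> {..T div d}"
    by (auto intro: div_le_mono)
  ultimately have "card ?S \<le> card {..T div d}"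
    by (intro card_inj_on_le) auto
  then show ?thesis
    by simp
qed

lemma sum_inverse_squares_le:
  assumes "K > 1"
  shows "(\<Sum>d = K..X. 1 / real d ^ 2) \<le> 1 / (real K - 1)"
proof (cases "K \<le> X")
  case True
  have "(\<Sum>d = K..X. 1 / real d ^ 2) \<le> (\<Sum>d = K..X. 1 / (real d - 1) - 1 / real d)"
    using assms by (intro sum_mono) (auto simp: field_simps power2_eq_square)
  also have "\<dots> = 1 / (real K - 1) - 1 / real X"
    using True assms by (induction X rule: dec_induct) (auto simp: sum.atLeast_Suc_atMost)
  finally show ?thesis
    by (smt (verit) divide_nonneg_nonneg of_nat_0_le_iff)
qed (use assms in auto)

text \<open>The harmonic sum is o(X): terms beyond \<open>n\<close> are below \<eta>, and the first
  \<open>n\<close> terms are at most 1 each. This will absorb the rounding errors \<open>+ 1\<close>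
  of the counting bound.\<close>

lemma sum_inverse_le_linear:
  assumes "\<eta> > 0"
  obtains C where "\<And>K X. K > 0 \<Longrightarrow> (\<Sum>d = K..X. 1 / real d) \<le> \<eta> * real X + C"
proof -
  obtain n :: nat where n: "n > 0" "1 / real n < \<eta>"
    using assms by (metis nat_approx_posE zero_less_Suc)
  show ?thesis
  proof
    fix K X :: nat
    assume "K > 0"
    have "(\<Sum>d = K..X. 1 / real d) \<le> (\<Sum>d = K..X. \<eta> + (if d \<le> n then 1 else 0))"
    proof (rule sum_mono)
      fix d assume "d \<in> {K..X}"
      with \<open>K > 0\<close> have "d > 0"
        by auto
      then have "d \<le> n \<or> 1 / real d \<le> 1 / real n" "1 / real d \<le> 1"
        using n by (auto simp: field_simps)
      then show "1 / real d \<le> \<eta> + (if d \<le> n then 1 else 0)"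
        using n assms by auto
    qed
    also have "\<dots> \<le> (\<Sum>d = 1..X. \<eta> + (if d \<le> n then 1 else 0))"
      using \<open>K > 0\<close> assms by (intro sum_mono2) auto
    also have "\<dots> = \<eta> * real X + real (card ({1..X} \<inter> {..n}))"
      by (simp add: sum.distrib sum.If_cases atMost_def)
    also have "card ({1..X} \<inter> {..n}) \<le> card {1..n}"
      by (intro card_mono) auto
    finally show "(\<Sum>d = K..X. 1 / real d) \<le> \<eta> * real X + real n"
      by simp
  qed
qed

text \<open>The divisor 1 cancels the \<open>- 1\<close>. Every other divisor of
  \<open>A * t + B\<close> is coprime to \<open>A\<close>, hence at least \<open>K\<close>. After
  exchanging the sums, \<open>d\<close> contributes at most T/d^2 plus the rounding error
  1/d.\<close>

lemma sum_sigma_ratio_le: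
  fixes A B K T :: nat
  assumes "coprime A B" "B > 0" "K > 1" and K: "\<And>d. d > 1 \<Longrightarrow> coprime A d \<Longrightarrow> d \<ge> K"
  shows "(\<Sum>t<T. real (sigma (A * t + B)) / real (A * t + B) - 1)
           \<le> real T / (real K - 1) + (\<Sum>d = K..A * T + B. 1 / real d)"
proof -
  let ?X = "A * T + B"
  let ?S = "\<lambda>d. {t. t < T \<and> d dvd A * t + B}"
  have cop: "coprime A d" if "d dvd A * t + B" for d t
  proof -
    have "coprime A (A * t + B)"
      using assms(1) gcd_add_mult[of A t B] by (simp only: coprime_iff_gcd_eq_1 mult.commute)
    then show ?thesis
      by (rule coprime_divisors[OF dvd_refl that])
  qed
  have "real (sigma (A * t + B)) / real (A * t + B) - 1
          = (\<Sum>d = K..?X. if d dvd A * t + B then 1 / real d else 0)" if "t < T" for t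
  proof -
    have "A * t + B \<le> ?X"
      using that by simp
    then have "d = 1 \<or> d \<in> {K..?X}" if "d dvd A * t + B" for d
      using K[OF _ cop[OF that]] dvd_imp_le[OF that] dvd_pos_nat[OF _ that] assms(2)
      unfolding atLeastAtMost_iff by (metis add_gr_0 le_trans less_one linorder_neqE_nat not_less0)
    then have eq: "{d. d dvd A * t + B} = insert 1 ({K..?X} \<inter> {d. d dvd A * t + B})"
      using one_dvd by blast
    have "(\<Sum>d | d dvd A * t + B. 1 / real d)
        = 1 + (\<Sum>d \<in> {K..?X} \<inter> {d. d dvd A * t + B}. 1 / real d)"
      by (subst eq, subst sum.insert) (use assms(3) in auto)
    then show ?thesis
      using assms(2) by (simp add: sum_inverse_divisors sum.inter_restrict)
  qed
  then have "(\<Sum>t<T. real (sigma (A * t + B)) / real (A * t + B) - 1)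
      = (\<Sum>t<T. \<Sum>d = K..?X. if d dvd A * t + B then 1 / real d else 0)"
    by simp
  also have "\<dots> = (\<Sum>d = K..?X. \<Sum>t<T. if d dvd A * t + B then 1 / real d else 0)"
    by (rule sum.swap)
  also have "\<dots> = (\<Sum>d = K..?X. real (card (?S d)) / real d)"
    by (intro sum.cong refl) (simp add: sum.If_cases lessThan_def Collect_conj_eq)
  also have "\<dots> \<le> (\<Sum>d = K..?X. real T * (1 / real d ^ 2) + 1 / real d)"
  proof (rule sum_mono)
    fix d assume "d \<in> {K..?X}"
    with assms(3) have d: "d > 0"
      by auto
    have "real (card (?S d)) \<le> real T / real d + 1"
    \<comment> \<open>A single element of \<open>?S d\<close> already forces \<open>d\<close> to be
      coprime to \<open>A\<close>, as the counting bound requires.\<close>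
    proof (cases "?S d = {}")
      case False
      then have "card (?S d) \<le> T div d + 1"
        using card_dvd_linear_le cop d by blast
      then show ?thesis
        using of_nat_div_le_of_nat[of T d, where ?'a = real] by linarith
    qed (metis add_nonneg_nonneg card.empty divide_nonneg_nonneg of_nat_0 of_nat_0_le_iff zero_le_one)
    then have "real (card (?S d)) / real d \<le> (real T / real d + 1) / real d"
      by (intro divide_right_mono) auto
    then show "real (card (?S d)) / real d \<le> real T * (1 / real d ^ 2) + 1 / real d"
      using d by (simp add: field_simps power2_eq_square)
  qed
  also have "\<dots> = real T * (\<Sum>d = K..?X. 1 / real d ^ 2) + (\<Sum>d = K..?X. 1 / real d)"
    by (simp add: sum.distrib sum_distrib_left)
  also have "\<dots> \<le> real T * (1 / (real K - 1)) + (\<Sum>d = K..?X. 1 / real d)"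
    by (intro add_right_mono mult_left_mono sum_inverse_squares_le assms) auto
  finally show ?thesis
    by simp
qed

text \<open>Markov's inequality: the excess \<open>sigma n / n - 1\<close> is nonnegative, and its
  sum over \<open>t < T\<close> is bounded.\<close>

lemma card_sigma_large_le:
  fixes A B K :: nat and \<epsilon> \<eta> :: real
  assumes "coprime A B" "A > 0" "B > 0" "K > 1"
    and K: "\<And>d. d > 1 \<Longrightarrow> coprime A d \<Longrightarrow> d \<ge> K"
    and "\<epsilon> > 0" "\<eta> > 0"
  obtains C where
    "\<And>T. real (card {t. t < T \<and> real (sigma (A * t + B)) \<ge> (1 + \<epsilon>) * real (A * t + B)})
       \<le> (1 / ((real K - 1) * \<epsilon>) + \<eta>) * real T + C"
proof -
  \<comment> \<open>The harmonic sum runs up to \<open>A * T + B\<close> and is later divided by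
    \<epsilon>; this choice leaves exactly \<eta> * T plus a constant.\<close>
  have "\<eta> * \<epsilon> / real A > 0"
    using assms by simp
  then obtain C where C: "\<And>K X. K > 0 \<Longrightarrow> (\<Sum>d = K..X. 1 / real d) \<le> \<eta> * \<epsilon> / real A * real X + C"
    using sum_inverse_le_linear by blast
  show ?thesis
  proof
    fix T
    let ?f = "\<lambda>t. real (sigma (A * t + B)) / real (A * t + B) - 1"
    let ?S = "{t. t < T \<and> real (sigma (A * t + B)) \<ge> (1 + \<epsilon>) * real (A * t + B)}"
    have f0: "?f t \<ge> 0" for t
    proof -
      have "A * t + B \<le> sigma (A * t + B)"
        using sigma_ge_sum[of "A * t + B" "{A * t + B}"] assms(3) by simp
      then have "real (A * t + B) \<le> real (sigma (A * t + B))"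
        by (simp only: of_nat_le_iff)
      then show ?thesis
        using assms(3) by (simp add: le_divide_eq del: of_nat_add of_nat_mult)
    qed
    have "real (card ?S) * \<epsilon> = (\<Sum>t\<in>?S. \<epsilon>)"
      by simp
    also have "\<dots> \<le> (\<Sum>t\<in>?S. ?f t)"
      using assms(3)
      by (intro sum_mono) (simp add: le_diff_eq le_divide_eq add.commute del: of_nat_add of_nat_mult)
    also have "\<dots> \<le> (\<Sum>t<T. ?f t)"
      using f0 by (intro sum_mono2) auto
    also have "\<dots> \<le> real T / (real K - 1) + (\<Sum>d = K..A * T + B. 1 / real d)"
      by (intro sum_sigma_ratio_le assms)
    also have "\<dots> \<le> real T / (real K - 1) + (\<eta> * \<epsilon> / real A * real (A * T + B) + C)"
      using C[of K "A * T + B"] assms by simp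
    finally have "real (card ?S) \<le> (real T / (real K - 1) + (\<eta> * \<epsilon> / real A * real (A * T + B) + C)) / \<epsilon>"
      using assms by (simp add: field_simps)
    also have "\<dots> = (1 / ((real K - 1) * \<epsilon>) + \<eta>) * real T + (\<eta> * real B / real A + C / \<epsilon>)"
      using assms by (simp add: field_simps)
    finally show "real (card ?S)
        \<le> (1 / ((real K - 1) * \<epsilon>) + \<eta>) * real T + (\<eta> * real B / real A + C / \<epsilon>)" .
  qed
qed

section \<open>Numerical facts about N\<close>

text \<open>The bound is 40 * 31, from 27 and 25, times p + 1 for each prime p from 7 to 37.\<close>

lemma sigma_lower_bound: "525278380032000 \<le> sigma 166966608033225"
proof -
  have step: "(p + 1) * c \<le> sigma (p * n)" if "c \<le> sigma n" "p > 1" "n > 0" "coprime p n" for p c n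
    using mult_le_mono[OF sigma_ge_Suc[OF that(2)] that(1)] sigma_mult_coprime_ge[of p n] that
    by linarith
  have "40 \<le> sigma 27"
    using sigma_ge_sum[of 27 "{1, 3, 9, 27}"] by simp
  moreover have "31 \<le> sigma 25"
    using sigma_ge_sum[of 25 "{1, 5, 25}"] by simp
  ultimately have "40 * 31 \<le> sigma 27 * sigma 25"
    by (rule mult_le_mono)
  also have "\<dots> \<le> sigma 675"
    using sigma_mult_coprime_ge[of 27 25] by (simp add: coprime_iff_gcd_eq_1 gcd_non_0_nat)
  finally have "1240 \<le> sigma 675"
    by simp
  from step[OF this, of 7] have "9920 \<le> sigma 4725"
    by (simp add: coprime_iff_gcd_eq_1 gcd_non_0_nat)
  from step[OF this, of 11] have "119040 \<le> sigma 51975"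
    by (simp add: coprime_iff_gcd_eq_1 gcd_non_0_nat)
  from step[OF this, of 13] have "1666560 \<le> sigma 675675"
    by (simp add: coprime_iff_gcd_eq_1 gcd_non_0_nat)
  from step[OF this, of 17] have "29998080 \<le> sigma 11486475"
    by (simp add: coprime_iff_gcd_eq_1 gcd_non_0_nat)
  from step[OF this, of 19] have "599961600 \<le> sigma 218243025"
    by (simp add: coprime_iff_gcd_eq_1 gcd_non_0_nat)
  from step[OF this, of 23] have "14399078400 \<le> sigma 5019589575"
    by (simp add: coprime_iff_gcd_eq_1 gcd_non_0_nat)
  from step[OF this, of 29] have "431972352000 \<le> sigma 145568097675"
    by (simp add: coprime_iff_gcd_eq_1 gcd_non_0_nat)
  from step[OF this, of 31] have "13823115264000 \<le> sigma 4512611027925"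
    by (simp add: coprime_iff_gcd_eq_1 gcd_non_0_nat)
  from step[OF this, of 37] have "525278380032000 \<le> sigma 166966608033225"
    by (simp add: coprime_iff_gcd_eq_1 gcd_non_0_nat)
  then show ?thesis .
qed

text \<open>The constant is \<open>12 N\<close>; the cube makes room for the factors 8, 16 and 32.\<close>

lemma coprime_imp_ge_41:
  fixes d :: nat
  assumes "d > 1" "coprime 2003599296398700 d"
  shows "d \<ge> 41"
proof (rule ccontr)
  assume "\<not> d \<ge> 41"
  with assms(1) have "d \<in> set [2..<41]"
    unfolding set_upt atLeastLessThan_iff by linarith
  moreover have "\<forall>d \<in> set [2..<41]. d dvd 2003599296398700 ^ 3"
    by simp
  ultimately have "d dvd 2003599296398700 ^ 3"
    by blast
  moreover have "coprime (2003599296398700 ^ 3) d"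
    using assms(2) unfolding coprime_power_left_iff by blast
  ultimately have "d = 1"
    by (metis coprime_common_divisor_nat dvd_refl)
  with assms(1) show False
    by simp
qed

section \<open>Counting the good parameters t\<close>

theorem theorem3:
  shows "infinite {m :: nat. m > 0 \<and> sigma (2 * m + 5) > sigma (6 * m + 17)
                            \<and> sigma (5 * m + 4) > sigma (6 * m + 7)}"
    (is "infinite ?G")
proof
  assume fin: "finite ?G"
  define N :: nat where "N = 166966608033225"
  \<comment> \<open>Since \<open>N\<close> is 1 modulo 4, the division is exact and its quotient is
    even.\<close>
  define m where "m = (\<lambda>t::nat. 2 * N * t + (N - 5) div 2)"
  have m_eqs: "2 * m t + 5 = (4 * t + 1) * N" "6 * m t + 17 = 12 * N * t + (3 * N + 2)"
      "6 * m t + 7 = 12 * N * t + (3 * N - 8)" "even (5 * m t + 4)"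
      "m t \<ge> 100" for t
    by (simp_all add: m_def N_def)
  define S1 where "S1 = (\<lambda>T. {t. t < T \<and>
    real (sigma (12 * N * t + (3 * N + 2))) \<ge> (1 + 1 / 25) * real (12 * N * t + (3 * N + 2))})"
  define S2 where "S2 = (\<lambda>T. {t. t < T \<and>
    real (sigma (12 * N * t + (3 * N - 8))) \<ge> (1 + 1 / 5) * real (12 * N * t + (3 * N - 8))})"
  have K: "\<And>d. d > 1 \<Longrightarrow> coprime (12 * N) d \<Longrightarrow> d \<ge> 41"
    using coprime_imp_ge_41 by (simp add: N_def)
  \<comment> \<open>Both numbers are odd, and they are congruent to 2 and -8 modulo the odd number
    \<open>3 * N\<close>.\<close>
  have cop: "coprime (12 * N) (3 * N + 2)" "coprime (12 * N) (3 * N - 8)"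
    by (simp_all add: N_def coprime_iff_gcd_eq_1 gcd_non_0_nat)
  have pos: "12 * N > 0" "3 * N + 2 > 0" "3 * N - 8 > 0" "(41 :: nat) > 1"
      "1 / 25 > (0 :: real)" "1 / 5 > (0 :: real)" "1 / 16 > (0 :: real)"
    by (simp_all add: N_def)
  obtain C1 where
    C1: "\<And>T. real (card (S1 T)) \<le> (1 / ((real 41 - 1) * (1 / 25)) + 1 / 16) * real T + C1"
    using card_sigma_large_le[OF cop(1) pos(1,2,4) K pos(5,7)] unfolding S1_def by blast
  obtain C2 where
    C2: "\<And>T. real (card (S2 T)) \<le> (1 / ((real 41 - 1) * (1 / 5)) + 1 / 16) * real T + C2"
    using card_sigma_large_le[OF cop(2) pos(1,3,4) K pos(6,7)] unfolding S2_def by blast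
  have good: "m t \<in> ?G" if "t < T" "t \<notin> S1 T" "t \<notin> S2 T" for t T
  proof -
    have "(4 * t + 1) * 525278380032000 \<le> (4 * t + 1) * sigma N"
      unfolding N_def by (intro mult_left_mono sigma_lower_bound) simp
    also have "\<dots> \<le> sigma (2 * m t + 5)"
      unfolding m_eqs by (rule sigma_mult_ge) (simp_all add: N_def)
    finally have "real ((4 * t + 1) * 525278380032000) \<le> real (sigma (2 * m t + 5))"
      by (simp only: of_nat_le_iff)
    moreover have "314 / 100 * real ((4 * t + 1) * N) \<le> real ((4 * t + 1) * 525278380032000)"
      by (simp add: N_def)
    ultimately have "314 / 100 * real (2 * m t + 5) \<le> real (sigma (2 * m t + 5))"
      unfolding m_eqs by linarith
    moreover have "real (sigma (6 * m t + 17)) < (1 + 1 / 25) * real (6 * m t + 17)"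
      using that unfolding S1_def m_eqs by simp
    \<comment> \<open>Here 6.28 m + 15.7 has to exceed 6.24 m + 17.68, which holds for m > 49.5;
      \<open>m t \<ge> 100\<close> suffices.\<close>
    ultimately have "real (sigma (6 * m t + 17)) < real (sigma (2 * m t + 5))"
      using m_eqs(5)[of t] by simp
    moreover have "3 * (5 * m t + 4) \<le> 2 * sigma (5 * m t + 4)"
      using m_eqs(4)[of t] by (intro sigma_even_ge) simp_all
    then have "3 * real (5 * m t + 4) \<le> 2 * real (sigma (5 * m t + 4))"
      by linarith
    moreover have "real (sigma (6 * m t + 7)) < (1 + 1 / 5) * real (6 * m t + 7)"
      using that unfolding S2_def m_eqs by simp
    ultimately show ?thesis
      using m_eqs(5)[of t] by simp
  qed
  have "inj m"
    by (rule injI) (simp add: m_def N_def)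
  define V where "V = m -` ?G"
  have "finite V"
    unfolding V_def by (rule finite_vimageI[OF fin \<open>inj m\<close>])
  \<comment> \<open>Each \<open>t < T\<close> is bad or lies in the finite set \<open>V\<close>. The
    bad ones have density at most 25/40 + 5/40 + 2/16 = 7/8, up to constants.\<close>
  have le: "real T \<le> 7 / 8 * real T + (C1 + C2 + real (card V))" for T
  proof -
    have "{..<T} \<subseteq> S1 T \<union> S2 T \<union> V"
      using good unfolding V_def by blast
    moreover have "finite (S1 T \<union> S2 T \<union> V)"
      using \<open>finite V\<close> by (simp add: S1_def S2_def)
    ultimately have "card {..<T} \<le> card (S1 T \<union> S2 T \<union> V)"
      by (rule card_mono[rotated])
    also have "\<dots> \<le> card (S1 T) + card (S2 T) + card V"
      by (rule order.trans[OF card_Un_le add_right_mono[OF card_Un_le]])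
    finally have "real T \<le> real (card (S1 T)) + real (card (S2 T)) + real (card V)"
      by simp
    then show ?thesis
      using C1[of T] C2[of T] by simp
  qed
  obtain T where "real T > 8 * (C1 + C2 + real (card V))"
    using reals_Archimedean2 by blast
  with le[of T] show False
    by (simp add: field_simps)
qed

end
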